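(* Let $r\ge 2$ be a fixed integer, let $\mathcal{T}$ be a set of primes and $\tau$ a positive constant with \[ \sum_{p\in\mathcal{T},\, p\le y}\frac{\log p}{\sqrt{p}}\ \ge\ (\tau+o(1))\,y^{1/2}\qquad (y\to\infty). \] Let $\mathcal{S}_{\mathcal{T}}=\{n\in\mathbb{N}_0:\ p\mid n \text{ and } p\in\mathcal{T} \text{ implies } p^r\mid n\}$. Let $F_1(N)$ denote the largest dimension $d$ such that there exist a non-negative integer $a_0$ and positive integers $a_1,\dots,a_d$ with $\mathcal{H}(a_0;a_1,\dots,a_d)\subset \mathcal{S}_{\mathcal{T}}\cap[1,N]$. Then \[ F_1(N)\ll_{\tau}\log N. \]
   Context: The Hilbert cube is $\mathcal{H}(a_0;a_1,\dots,a_d)=a_0+\{0,a_1\}+\cdots+\{0,a_d\}=\{a_0+\sum_{i\in I}a_i:\ I\subseteq\{1,\dots,d\}\}$. $\mathbb{N}_0$ denotes the non-negative integers. The notation $X\ll_\tau Y$ means $X\le CY$ for a constant $C$ depending only on $\tau$ (for all sufficiently large $N$). *)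

theory Defs
  imports Complex_Main "HOL-Computational_Algebra.Primes" "HOL-Library.Landau_Symbols"
begin

definition hilbert_cube :: "nat \<Rightarrow> (nat \<Rightarrow> nat) \<Rightarrow> nat \<Rightarrow> nat set" where
  "hilbert_cube a0 a d = {a0 + (\<Sum>i\<in>I. a i) | I. I \<subseteq> {1..d}}"

definition S_set :: "nat \<Rightarrow> nat set \<Rightarrow> nat set" where
  "S_set r T = {n. \<forall>p. p dvd n \<and> p \<in> T \<longrightarrow> p ^ r dvd n}"

text \<open>Only the values \<open>a 1, \<dots>, a d\<close> matter; they need not be distinct.\<close>
definition cube_dims :: "nat \<Rightarrow> nat set \<Rightarrow> nat \<Rightarrow> nat set" where
  "cube_dims r T N =
     {d. \<exists>a0 a. (\<forall>i\<in>{1..d}. a i > 0) \<and> hilbert_cube a0 a d \<subseteq> S_set r T \<inter> {1..N}}"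

text \<open>The maximum exists for \<open>N \<ge> 1\<close> when \<open>T\<close> consists of primes:
  see \<open>finite_cube_dims\<close> and \<open>zero_in_cube_dims\<close> below.\<close>
definition F1 :: "nat \<Rightarrow> nat set \<Rightarrow> nat \<Rightarrow> nat" where
  "F1 r T N = Max (cube_dims r T N)"

lemma finite_cube_dims: "finite (cube_dims r T N)"
proof (rule finite_subset)
  show "cube_dims r T N \<subseteq> {..N}"
  proof
    fix d assume "d \<in> cube_dims r T N"
    then obtain a0 a where pos: "\<forall>i\<in>{1..d}. a i > 0"
      and sub: "hilbert_cube a0 a d \<subseteq> S_set r T \<inter> {1..N}"
      unfolding cube_dims_def by blast
    have "a0 + (\<Sum>i\<in>{1..d}. a i) \<in> hilbert_cube a0 a d"
      unfolding hilbert_cube_def by blast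
    with sub have "a0 + (\<Sum>i\<in>{1..d}. a i) \<le> N" by auto
    moreover have "(\<Sum>i\<in>{1..d}. 1) \<le> (\<Sum>i\<in>{1..d}. a i)"
      by (rule sum_mono) (use pos in \<open>auto simp: Suc_le_eq\<close>)
    ultimately show "d \<in> {..N}" by simp
  qed
qed simp

lemma zero_in_cube_dims:
  assumes "T \<subseteq> {p. prime p}" "N \<ge> 1"
  shows "0 \<in> cube_dims r T N"
proof -
  have "hilbert_cube 1 a 0 \<subseteq> S_set r T \<inter> {1..N}" for a
    using assms by (auto simp: hilbert_cube_def S_set_def)
  then show ?thesis unfolding cube_dims_def by fastforce
qed

end

theory Submission
  imports Defs "HOL-Number_Theory.Cong"
begin

text \<open>
  For \<open>p \<in> T\<close> fewer than \<open>2 * p\<close> of the sides \<open>a 1, \<dots>, a d\<close> of a cube in \<open>S_set r T\<close> are prime to \<open>p\<close>.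
  So every \<open>p \<in> T\<close> with \<open>p \<le> d / 4\<close> divides at least half of the sides, and comparing with
  \<open>a 1 * \<dots> * a d \<le> N ^ d\<close> gives \<open>\<Sum>p\<in>T, p\<le>d/4. ln p \<le> 2 * ln N\<close>. The density hypothesis,
  together with a Chebyshev bound, makes the left-hand side at least linear in \<open>d\<close>.
\<close>

section \<open>Subset sums modulo a prime and modulo its square\<close>

text \<open>Adjoining a summand \<open>a i\<close> prime to \<open>p\<close> either produces a new
  residue or leaves the set of residues closed under translation by \<open>a i\<close>. In the
  latter case the set contains all multiples of \<open>a i\<close>, hence every residue mod
  \<open>p\<close>.\<close>

lemma card_subset_sums_mod_ge:
  fixes a :: "'a \<Rightarrow> nat"
  assumes "prime p" "finite I" "\<And>i. i \<in> I \<Longrightarrow> \<not> p dvd a i"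
  shows "min p (card I + 1) \<le> card ((\<lambda>J. sum a J mod p) ` Pow I)"
  using assms(2,3)
proof (induction I rule: finite_induct)
  case empty
  then show ?case by simp
next
  case (insert i I)
  have p: "p > 0" using \<open>prime p\<close> by (simp add: prime_gt_0_nat)
  define R where "R = (\<lambda>J. sum a J mod p) ` Pow I"
  define R' where "R' = (\<lambda>J. sum a J mod p) ` Pow (insert i I)"
  have fin: "finite R'" and sub: "R \<subseteq> R'"
    using insert.hyps by (auto simp: R_def R'_def)
  have IH: "min p (card I + 1) \<le> card R"
    using insert unfolding R_def by simp
  have shift: "(x + a i) mod p \<in> R'" if "x \<in> R" for x
  proof -
    from that obtain J where J: "J \<subseteq> I" "x = sum a J mod p"
      unfolding R_def by auto
    have "sum a (insert i J) = sum a J + a i"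
      using J insert.hyps by (subst sum.insert) (auto intro: finite_subset)
    then have "(x + a i) mod p = sum a (insert i J) mod p"
      using J by (simp add: mod_add_left_eq)
    then show ?thesis
      unfolding R'_def using J by blast
  qed
  have "min p (card I + 2) \<le> card R'"
  proof (cases "R = R'")
    case True
    have mem: "k * a i mod p \<in> R" for k
    proof (induction k)
      case 0
      have "sum a {} mod p \<in> R" unfolding R_def by blast
      then show ?case by simp
    next
      case (Suc k)
      then show ?case
        using shift[of "k * a i mod p"] True by (simp add: mod_add_right_eq add.commute)
    qed
    have "coprime (a i) p"
      using insert.prems[of i] \<open>prime p\<close> prime_imp_coprime coprime_commute by blast
    then have "inj_on (\<lambda>k. k * a i mod p) {..<p}"
      by (intro inj_onI) (metis cong_def cong_less_modulus_unique_nat cong_mult_rcancel_nat lessThan_iff)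
    then have "p \<le> card R"
      using card_inj_on_le[of "\<lambda>k. k * a i mod p" "{..<p}" R] mem fin True by auto
    then show ?thesis using True by simp
  next
    case False
    then have "card R < card R'"
      using sub fin by (simp add: psubset_card_mono psubsetI)
    then show ?thesis using IH by simp
  qed
  then show ?case
    using insert.hyps unfolding R'_def by simp
qed

text \<open>With at least \<open>p - 1\<close> summands prime to \<open>p\<close>, the lower bound
  for the number of residues reaches \<open>p\<close>.\<close>

lemma ex_subset_sum_cong:
  fixes a :: "'a \<Rightarrow> nat"
  assumes "prime p" "finite I" "\<And>i. i \<in> I \<Longrightarrow> \<not> p dvd a i" "p \<le> card I + 1"
  shows "\<exists>J\<subseteq>I. [sum a J = t] (mod p)"
proof -
  let ?R = "(\<lambda>J. sum a J mod p) ` Pow I"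
  have p: "p > 0" using \<open>prime p\<close> by (simp add: prime_gt_0_nat)
  have "p \<le> card ?R"
    using card_subset_sums_mod_ge[OF assms(1-3)] assms(4) by simp
  moreover have "?R \<subseteq> {..<p}" using p by auto
  ultimately have "?R = {..<p}"
    by (intro card_seteq) auto
  then have "t mod p \<in> ?R" using p by simp
  then show ?thesis by (auto simp: cong_def)
qed

text \<open>
  If many summands were prime to \<open>p\<close>, a reserve of \<open>p - 1\<close> of them could steer any subset sum of the
  others into the class \<open>0\<close> mod \<open>p\<close>, so these sums would be determined mod \<open>p\<^sup>2\<close> by their residue
  mod \<open>p\<close>. Adding one more summand \<open>b\<close> exactly \<open>p\<close> times then gives \<open>p * b \<equiv> 0\<close> mod \<open>p\<^sup>2\<close>.
\<close>
lemma card_not_dvd_less: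
  fixes a :: "'a \<Rightarrow> nat"
  assumes "prime p" "finite D"
    and lift: "\<And>J. J \<subseteq> D \<Longrightarrow> p dvd a0 + sum a J \<Longrightarrow> p\<^sup>2 dvd a0 + sum a J"
  shows "card {i\<in>D. \<not> p dvd a i} < 2 * p"
proof (rule ccontr)
  define E where "E = {i\<in>D. \<not> p dvd a i}"
  assume "\<not> card {i\<in>D. \<not> p dvd a i} < 2 * p"
  then have cE: "2 * p \<le> card E" by (simp add: E_def)
  have p: "p > 0" using \<open>prime p\<close> by (simp add: prime_gt_0_nat)
  have fE: "finite E" using \<open>finite D\<close> by (simp add: E_def)
  \<comment> \<open>Budget for the \<open>2 * p\<close> elements: \<open>p\<close> go to
    \<open>I\<close>, one is \<open>b\<close>, and at least \<open>p - 1\<close> remain for the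
    reserve \<open>K\<close>, enough to reach every residue.\<close>
  obtain I where I: "I \<subseteq> E" "card I = p" "finite I"
    using obtain_subset_with_card_n[of p E] cE by auto
  have "card (E - I) \<ge> p"
    using cE I by (simp add: card_Diff_subset)
  then obtain b where b: "b \<in> E" "b \<notin> I"
    using p by (metis DiffE card.empty ex_in_conv le_zero_eq less_numeral_extra(3))
  define K where "K = E - insert b I"
  have "card K + 1 \<ge> p"
    unfolding K_def using cE I b by (subst card_Diff_subset) auto
  then have coverK: "\<exists>L\<subseteq>K. [sum a L = t] (mod p)" for t
    by (intro ex_subset_sum_cong) (use \<open>prime p\<close> fE in \<open>auto simp: K_def E_def\<close>)
  have rigid: "[sum a J = sum a J'] (mod p\<^sup>2)"
    if J: "J \<subseteq> insert b I" "J' \<subseteq> insert b I" "[sum a J = sum a J'] (mod p)" for J J'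
  proof -
    \<comment> \<open>The factor \<open>p - 1\<close> plays the role of -1 mod \<open>p\<close>, so
      adding \<open>L\<close> brings the sum over \<open>J\<close> to 0 mod \<open>p\<close>. The
      same \<open>L\<close> works for \<open>J'\<close>, and cancelling it compares the two sums mod
      \<open>p\<^sup>2\<close>.\<close>
    obtain L where L: "L \<subseteq> K" "[sum a L = (p - 1) * (a0 + sum a J)] (mod p)"
      using coverK by blast
    have fL: "finite L" using L fE by (auto simp: K_def intro: finite_subset)
    have un: "sum a (M \<union> L) = sum a M + sum a L" if "M \<subseteq> insert b I" for M
      using that L fL I by (intro sum.union_disjoint) (auto simp: K_def intro: finite_subset)
    have sq: "p\<^sup>2 dvd a0 + sum a M + sum a L"
      if M: "M \<subseteq> insert b I" "[sum a J = sum a M] (mod p)" for M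
    proof -
      have "[a0 + sum a M + sum a L = a0 + sum a J + (p - 1) * (a0 + sum a J)] (mod p)"
        using L M by (intro cong_add) (auto intro: cong_sym)
      also have "a0 + sum a J + (p - 1) * (a0 + sum a J) = p * (a0 + sum a J)"
        using p by (metis Suc_diff_1 mult_Suc)
      finally have "p dvd a0 + sum a M + sum a L"
        by (simp add: cong_def mod_eq_0_iff_dvd)
      moreover have "M \<union> L \<subseteq> D"
        using M L I b by (auto simp: K_def E_def)
      ultimately show ?thesis
        using lift[of "M \<union> L"] un[OF M(1)] by (simp add: add.assoc)
    qed
    have "[(a0 + sum a L) + sum a J = (a0 + sum a L) + sum a J'] (mod p\<^sup>2)"
      using sq[of J] sq[of J'] J by (simp add: cong_def add_ac mod_eq_0_iff_dvd)
    then show ?thesis by (simp only: cong_add_lcancel_nat)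
  qed
  have "\<exists>J\<subseteq>I. [sum a J = t] (mod p)" for t
    by (intro ex_subset_sum_cong) (use \<open>prime p\<close> I in \<open>auto simp: E_def\<close>)
  then obtain F where F: "\<And>t. F t \<subseteq> I" "\<And>t. [sum a (F t) = t] (mod p)"
    by metis
  \<comment> \<open>A subset can contain \<open>b\<close> only once. After each addition of
    \<open>a b\<close> the set is therefore exchanged for one inside \<open>I\<close>, which avoids
    \<open>b\<close>; by \<open>rigid\<close> this does not change the sum mod
    \<open>p\<^sup>2\<close>.\<close>
  have step: "[sum a (F (t + a b)) = sum a (F t) + a b] (mod p\<^sup>2)" for t
  proof -
    have ins: "sum a (insert b (F t)) = sum a (F t) + a b"
      using F(1)[of t] I b by (subst sum.insert) (auto intro: finite_subset)
    have "[sum a (F t) + a b = t + a b] (mod p)"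
      using F(2) by (intro cong_add) auto
    then have "[sum a (F (t + a b)) = sum a (insert b (F t))] (mod p)"
      unfolding ins using F(2)[of "t + a b"] by (meson cong_sym cong_trans)
    then show ?thesis
      using rigid[of "F (t + a b)" "insert b (F t)"] F(1) ins by fastforce
  qed
  have iter: "[sum a (F (k * a b)) = sum a (F 0) + k * a b] (mod p\<^sup>2)" for k
  proof (induction k)
    case (Suc k)
    have "[sum a (F (k * a b)) + a b = sum a (F 0) + k * a b + a b] (mod p\<^sup>2)"
      using Suc by (intro cong_add) auto
    then show ?case
      using step[of "k * a b"] cong_trans by (fastforce simp: add_ac)
  qed simp
  have "[sum a (F (p * a b)) = sum a (F 0)] (mod p)"
    using F(2)[of "p * a b"] F(2)[of 0] by (simp add: cong_def)
  then have "[sum a (F (p * a b)) = sum a (F 0)] (mod p\<^sup>2)"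
    by (intro rigid) (use F(1) in blast)+
  then have "[sum a (F 0) + p * a b = sum a (F 0) + 0] (mod p\<^sup>2)"
    using iter[of p] by (metis add_0_right cong_sym cong_trans)
  then have "[p * a b = 0] (mod p\<^sup>2)"
    by (simp only: cong_add_lcancel_nat)
  then have "p * p dvd p * a b"
    by (simp add: cong_def mod_eq_0_iff_dvd power2_eq_square)
  then have "p dvd a b" using p by simp
  then show False using b by (simp add: E_def)
qed

section \<open>Chebyshev-type bounds and weighted sums over primes\<close>

lemma prod_primes_dvd:
  fixes n :: nat
  assumes "finite P" "\<And>p. p \<in> P \<Longrightarrow> prime p" "\<And>p. p \<in> P \<Longrightarrow> p dvd n"
  shows "\<Prod>P dvd n"
  using assms
proof (induction P rule: finite_induct)
  case (insert p P)
  have "coprime p (\<Prod>P)"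
    using insert by (intro prod_coprime_right) (metis insertCI primes_coprime)
  then show ?case using insert by (simp add: divides_mult)
qed simp

text \<open>The product of distinct prime divisors of \<open>n\<close> divides \<open>n\<close>;
  take logarithms. This serves both for binomial coefficients and for the sides of a cube.\<close>

lemma sum_ln_primes_le:
  fixes n :: nat
  assumes "finite P" "\<And>p. p \<in> P \<Longrightarrow> prime p" "\<And>p. p \<in> P \<Longrightarrow> p dvd n" "n > 0"
  shows "(\<Sum>p\<in>P. ln (real p)) \<le> ln (real n)"
proof -
  have pos: "p > 0" if "p \<in> P" for p
    using that assms(2) by (simp add: prime_gt_0_nat)
  have "(\<Sum>p\<in>P. ln (real p)) = ln (\<Prod>p\<in>P. real p)"
    using pos assms(1) by (subst ln_prod) auto
  also have "\<dots> = ln (real (\<Prod>P))" by simp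
  also have "\<dots> \<le> ln (real n)"
  proof -
    have "\<Prod>P \<le> n" using prod_primes_dvd[OF assms(1-3)] \<open>n > 0\<close> by (auto intro: dvd_imp_le)
    moreover have "\<Prod>P > 0" using pos by (intro prod_pos) auto
    ultimately show ?thesis by (simp only: ln_le_cancel_iff of_nat_0_less_iff of_nat_le_iff \<open>n > 0\<close>)
  qed
  finally show ?thesis .
qed

text \<open>Chebyshev's argument: each prime in the range divides \<open>(2 * n)!\<close> but not
  \<open>n!\<close>, so it divides the central binomial coefficient, which is at most
  \<open>2 ^ (2 * n)\<close>.\<close>

lemma sum_ln_primes_dyadic_le:
  "(\<Sum>p | prime p \<and> n < p \<and> p \<le> 2 * n. ln (real p)) \<le> 2 * real n * ln 2"
proof -
  let ?B = "(2 * n) choose n"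
  have "(\<Sum>p | prime p \<and> n < p \<and> p \<le> 2 * n. ln (real p)) \<le> ln (real ?B)"
  proof (rule sum_ln_primes_le)
    show "finite {p. prime p \<and> n < p \<and> p \<le> 2 * n}"
      by (rule finite_subset[of _ "{..2*n}"]) auto
    show "p dvd ?B" if "p \<in> {p. prime p \<and> n < p \<and> p \<le> 2 * n}" for p
    proof -
      have "p dvd fact n * fact n * ?B"
        using binomial_fact_lemma[of n "2 * n"] that by (auto simp: mult_2 prime_dvd_fact_iff)
      then show ?thesis
        using that by (auto simp: prime_dvd_mult_iff prime_dvd_fact_iff)
    qed
  qed auto
  also have "\<dots> \<le> ln (2 ^ (2 * n))"
  proof (subst ln_le_cancel_iff)
    show "real ?B \<le> 2 ^ (2 * n)"
      using binomial_le_pow2[of "2 * n" n] by (metis numeral_power_eq_of_nat_cancel_iff of_nat_le_iff)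
  qed auto
  also have "\<dots> = 2 * real n * ln 2" by (simp add: ln_realpow)
  finally show ?thesis .
qed

text \<open>Induction over dyadic blocks: on the block from \<open>n\<close> to \<open>2 * n\<close>
  the weight is at most \<open>1 / sqrt n\<close>, so the block contributes at most
  \<open>2 * sqrt n\<close>.\<close>

lemma sum_ln_div_sqrt_primes_pow2_le:
  "(\<Sum>p | prime p \<and> p \<le> 2 ^ k. ln (real p) / sqrt (real p)) \<le> 5 * sqrt (2 ^ k)"
proof (induction k)
  case 0
  have "{p::nat. prime p \<and> p \<le> 2 ^ 0} = {}"
    by (auto dest: prime_gt_1_nat)
  then show ?case by (simp only: sum.empty) simp
next
  case (Suc k)
  define n :: nat where "n = 2 ^ k"
  have n: "real n > 0" "real n = 2 ^ k" by (simp_all add: n_def)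
  let ?g = "\<lambda>p::nat. ln (real p) / sqrt (real p)"
  let ?A = "{p. prime p \<and> p \<le> n}" and ?B = "{p. prime p \<and> n < p \<and> p \<le> 2 * n}"
  have fin: "finite ?A" "finite ?B"
    by (auto intro: finite_subset[of _ "{..2 * n}"])
  have "{p. prime p \<and> p \<le> 2 ^ Suc k} = ?A \<union> ?B" by (auto simp: n_def)
  then have "sum ?g {p. prime p \<and> p \<le> 2 ^ Suc k} = sum ?g ?A + sum ?g ?B"
    using fin by (simp only:) (rule sum.union_disjoint, auto)
  moreover have "sum ?g ?A \<le> 5 * sqrt (real n)"
    using Suc by (simp add: n_def)
  moreover have "sum ?g ?B \<le> 2 * sqrt (real n)"
  proof -
    have "sum ?g ?B \<le> (\<Sum>p\<in>?B. ln (real p) / sqrt (real n))"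
      using n by (intro sum_mono divide_left_mono) auto
    also have "\<dots> = (\<Sum>p\<in>?B. ln (real p)) / sqrt (real n)"
      by (simp add: sum_divide_distrib)
    also have "\<dots> \<le> 2 * real n * 1 / sqrt (real n)"
    proof (intro divide_right_mono)
      have "2 * real n * ln 2 \<le> 2 * real n * 1"
        using ln_2_less_1 by (intro mult_left_mono) auto
      then show "(\<Sum>p\<in>?B. ln (real p)) \<le> 2 * real n * 1"
        using sum_ln_primes_dyadic_le[of n] by linarith
    qed simp
    also have "\<dots> = 2 * sqrt (real n)" by (simp add: real_div_sqrt flip: times_divide_eq_right)
    finally show ?thesis .
  qed
  \<comment> \<open>The constant 5 closes the induction because 5 + 2 \<le> 5 * sqrt 2.\<close>
  moreover have "7 * sqrt (real n) \<le> 5 * sqrt (2 ^ Suc k)"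
  proof -
    have "7 / 5 \<le> sqrt (2::real)" by (rule real_le_rsqrt) (simp add: power2_eq_square)
    then have "7 / 5 * sqrt (real n) \<le> sqrt 2 * sqrt (real n)"
      by (rule mult_right_mono) simp
    then show ?thesis by (simp add: n real_sqrt_mult)
  qed
  ultimately show ?case by linarith
qed

lemma ln_prime_nonneg: "ln (real p) \<ge> 0" if "prime p"
  using prime_ge_1_nat[OF that] by simp

lemma finite_nat_real_le: "finite {p::nat. Q p \<and> real p \<le> x}"
proof (rule finite_subset)
  show "{p::nat. Q p \<and> real p \<le> x} \<subseteq> {..nat \<lfloor>x\<rfloor>}" by (auto simp: le_nat_floor)
qed simp

text \<open>Replace \<open>x\<close> by a power of two between \<open>x\<close> and
  \<open>2 * x\<close>; the loss of \<open>sqrt 2\<close> turns the constant 5 into at most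
  8.\<close>

lemma sum_ln_div_sqrt_primes_le:
  assumes "x \<ge> 0"
  shows "(\<Sum>p | prime p \<and> real p \<le> x. ln (real p) / sqrt (real p)) \<le> 8 * sqrt x"
proof (cases "x < 1")
  case True
  then have "{p::nat. prime p \<and> real p \<le> x} = {}"
    by (auto dest: prime_ge_1_nat)
  then show ?thesis using assms by (simp only: sum.empty) simp
next
  case False
  then obtain k where "2 ^ k \<le> nat \<lfloor>x\<rfloor>" "nat \<lfloor>x\<rfloor> < 2 ^ (k + 1)"
    using ex_power_ivl1[of 2 "nat \<lfloor>x\<rfloor>"] by (auto simp: le_nat_floor)
  then have k: "2 ^ k \<le> x" "x < 2 ^ (k + 1)"
    using assms by (simp_all add: le_nat_iff nat_less_iff le_floor_iff floor_less_iff)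
  have "(\<Sum>p | prime p \<and> real p \<le> x. ln (real p) / sqrt (real p))
      \<le> (\<Sum>p | prime p \<and> p \<le> 2 ^ (k + 1). ln (real p) / sqrt (real p))"
  proof (rule sum_mono2)
    show "{p. prime p \<and> real p \<le> x} \<subseteq> {p. prime p \<and> p \<le> 2 ^ (k + 1)}"
    proof safe
      fix p :: nat assume "real p \<le> x"
      then have "real p \<le> real (2 ^ (k + 1))" using k by simp
      then show "p \<le> 2 ^ (k + 1)" by (simp only: of_nat_le_iff)
    qed
  qed (auto simp: ln_prime_nonneg intro: finite_subset[of _ "{..2 ^ (k + 1)}"])
  also have "\<dots> \<le> 5 * sqrt (2 ^ (k + 1))" by (rule sum_ln_div_sqrt_primes_pow2_le)
  also have "\<dots> \<le> 5 * sqrt (2 * x)" using k by simp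
  also have "\<dots> \<le> 8 * sqrt x"
  proof -
    have "sqrt 2 \<le> (8 / 5 :: real)" by (rule real_le_lsqrt) (auto simp: power2_eq_square)
    then have "sqrt 2 * sqrt x \<le> 8 / 5 * sqrt x" using assms by (intro mult_right_mono) auto
    then show ?thesis by (simp add: real_sqrt_mult)
  qed
  finally show ?thesis .
qed

text \<open>
  By the Chebyshev bound the primes below \<open>(\<tau>/32)\<^sup>2 * y\<close> account for at most half of the
  hypothesised sum; for the others \<open>1 / sqrt p\<close> is at most \<open>32 / (\<tau> * sqrt y)\<close>.
\<close>
lemma sum_ln_ge_linear:
  fixes y \<tau> :: real
  assumes "\<tau> > 0" "y > 0" "T \<subseteq> {p. prime p}"
    and "(\<Sum>p | p \<in> T \<and> real p \<le> y. ln (real p) / sqrt (real p)) \<ge> \<tau> / 2 * sqrt y"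
  shows "(\<Sum>p | p \<in> T \<and> real p \<le> y. ln (real p)) \<ge> \<tau>\<^sup>2 / 128 * y"
proof -
  let ?g = "\<lambda>p::nat. ln (real p) / sqrt (real p)"
  \<comment> \<open>The factor 32 makes the bound \<open>8 * sqrt x\<close> for the small primes
    equal to \<open>\<tau> / 4 * sqrt y\<close>.\<close>
  define x where "x = (\<tau> / 32)\<^sup>2 * y"
  have sx: "sqrt x = \<tau> / 32 * sqrt y" and x: "x > 0"
    using assms(1,2) by (simp_all add: x_def real_sqrt_mult)
  let ?Y = "{p. p \<in> T \<and> real p \<le> y}"
  let ?X = "{p\<in>?Y. real p \<le> x}"
  let ?Z = "{p\<in>?Y. x < real p}"
  have fin: "finite ?Y" by (rule finite_nat_real_le)
  have nonneg: "ln (real p) \<ge> 0" if "p \<in> T" for p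
    using that assms(3) ln_prime_nonneg by auto
  have "?Y = ?X \<union> ?Z" by auto
  then have "sum ?g ?Y = sum ?g ?X + sum ?g ?Z"
    using fin by (metis (no_types, lifting) sum.union_disjoint finite_Un disjoint_iff mem_Collect_eq not_le)
  moreover have "sum ?g ?X \<le> \<tau> / 4 * sqrt y"
  proof -
    have "sum ?g ?X \<le> (\<Sum>p | prime p \<and> real p \<le> x. ?g p)"
      using assms(3) by (intro sum_mono2 finite_nat_real_le) (auto simp: ln_prime_nonneg)
    also have "\<dots> \<le> 8 * sqrt x" using x by (intro sum_ln_div_sqrt_primes_le) simp
    finally show ?thesis by (simp add: sx)
  qed
  moreover have "sum ?g ?Z \<le> (\<Sum>p\<in>?Y. ln (real p)) / sqrt x"
  proof -
    have "sum ?g ?Z \<le> (\<Sum>p\<in>?Z. ln (real p) / sqrt x)"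
      using x nonneg by (intro sum_mono divide_left_mono) auto
    also have "\<dots> \<le> (\<Sum>p\<in>?Y. ln (real p) / sqrt x)"
      using fin nonneg x by (intro sum_mono2) auto
    finally show ?thesis by (simp add: sum_divide_distrib)
  qed
  ultimately have "\<tau> / 4 * sqrt y \<le> (\<Sum>p\<in>?Y. ln (real p)) / sqrt x"
    using assms(4) by linarith
  then have "\<tau> / 4 * sqrt y * sqrt x \<le> (\<Sum>p\<in>?Y. ln (real p))"
    using x by (simp add: pos_le_divide_eq)
  moreover have "\<tau> / 4 * sqrt y * sqrt x = \<tau>\<^sup>2 / 128 * y"
    unfolding sx using assms(2) by (simp add: power2_eq_square)
  ultimately show ?thesis by linarith
qed

section \<open>Prime divisors of the sides of a cube and the final estimate\<close>

text \<open>Double counting of the pairs with \<open>p dvd a i\<close>, weighted by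
  \<open>ln p\<close>: each \<open>p\<close> occurs with at least \<open>d / 2\<close> sides, while
  each side has total weight at most \<open>ln (a i)\<close>, hence at most
  \<open>ln N\<close>.\<close>

lemma sum_ln_le_of_cube_dims:
  assumes "r \<ge> 2" "T \<subseteq> {p. prime p}" "d \<in> cube_dims r T N" "d > 0"
  shows "(\<Sum>p | p \<in> T \<and> real p \<le> real d / 4. ln (real p)) \<le> 2 * ln (real N)"
proof -
  obtain a0 a where pos: "\<And>i. i \<in> {1..d} \<Longrightarrow> a i > 0"
    and sub: "hilbert_cube a0 a d \<subseteq> S_set r T \<inter> {1..N}"
    using assms(3) unfolding cube_dims_def by blast
  have mem: "a0 + sum a J \<in> S_set r T" "a0 + sum a J \<le> N" if "J \<subseteq> {1..d}" for J
  proof -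
    have "a0 + sum a J \<in> hilbert_cube a0 a d"
      using that unfolding hilbert_cube_def by blast
    then show "a0 + sum a J \<in> S_set r T" "a0 + sum a J \<le> N" using sub by auto
  qed
  let ?P = "{p. p \<in> T \<and> real p \<le> real d / 4}"
  have fin: "finite ?P" by (rule finite_nat_real_le)
  \<comment> \<open>The cutoff \<open>d / 4\<close> gives \<open>2 * p \<le> d / 2\<close>, so fewer
    than half of the sides are prime to \<open>p\<close>.\<close>
  have half: "real d / 2 \<le> real (card {i\<in>{1..d}. p dvd a i})" if "p \<in> ?P" for p
  proof -
    have "card {i\<in>{1..d}. \<not> p dvd a i} < 2 * p"
    proof (rule card_not_dvd_less)
      fix J assume "J \<subseteq> {1..d}" "p dvd a0 + sum a J"
      then have "p ^ r dvd a0 + sum a J"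
        using mem that by (auto simp: S_set_def)
      then show "p\<^sup>2 dvd a0 + sum a J"
        using \<open>r \<ge> 2\<close> by (meson le_imp_power_dvd dvd_trans)
    qed (use that assms(2) in auto)
    moreover have "card {i\<in>{1..d}. p dvd a i} + card {i\<in>{1..d}. \<not> p dvd a i} = d"
    proof -
      have "card ({i\<in>{1..d}. p dvd a i} \<union> {i\<in>{1..d}. \<not> p dvd a i})
          = card {i\<in>{1..d}. p dvd a i} + card {i\<in>{1..d}. \<not> p dvd a i}"
        by (rule card_Un_disjoint) auto
      moreover have "{i\<in>{1..d}. p dvd a i} \<union> {i\<in>{1..d}. \<not> p dvd a i} = {1..d}"
        by auto
      ultimately show ?thesis by simp
    qed
    ultimately show ?thesis using that by simp
  qed
  have "(real d / 2) * (\<Sum>p\<in>?P. ln (real p))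
      \<le> (\<Sum>p\<in>?P. real (card {i\<in>{1..d}. p dvd a i}) * ln (real p))"
    unfolding sum_distrib_left
    using half assms(2) by (intro sum_mono mult_right_mono) (auto simp: ln_prime_nonneg subset_iff)
  also have "\<dots> = (\<Sum>p\<in>?P. \<Sum>i | i \<in> {1..d} \<and> p dvd a i. ln (real p))"
    by simp
  also have "\<dots> = (\<Sum>i\<in>{1..d}. \<Sum>p | p \<in> ?P \<and> p dvd a i. ln (real p))"
    using fin by (intro sum.swap_restrict) auto
  also have "\<dots> \<le> (\<Sum>i\<in>{1..d}. ln (real N))"
  proof (rule sum_mono)
    fix i assume i: "i \<in> {1..d}"
    have "(\<Sum>p | p \<in> ?P \<and> p dvd a i. ln (real p)) \<le> ln (real (a i))"
      using fin assms(2) pos[OF i] by (intro sum_ln_primes_le) auto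
    also have "\<dots> \<le> ln (real N)"
      using mem(2)[of "{i}"] i pos[OF i] by simp
    finally show "(\<Sum>p | p \<in> ?P \<and> p dvd a i. ln (real p)) \<le> ln (real N)" .
  qed
  also have "\<dots> = (real d / 2) * (2 * ln (real N))" by simp
  finally show ?thesis using \<open>d > 0\<close> by (simp only: mult_le_cancel_left_pos half_gt_zero_iff of_nat_0_less_iff)
qed

theorem theorem1p4:
  fixes \<tau> :: real
  assumes "\<tau> > 0"
  shows "\<exists>C>0. \<forall>r::nat. \<forall>T::nat set. r \<ge> 2 \<longrightarrow> T \<subseteq> {p. prime p} \<longrightarrow>
           (\<exists>\<epsilon>::real \<Rightarrow> real. \<epsilon> \<in> o[at_top](\<lambda>_. 1) \<and>
              (\<forall>\<^sub>F y in at_top.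
                 (\<Sum>p | p \<in> T \<and> real p \<le> y. ln (real p) / sqrt (real p))
                   \<ge> (\<tau> + \<epsilon> y) * y powr (1/2))) \<longrightarrow>
           (\<forall>\<^sub>F N in sequentially. real (F1 r T N) \<le> C * ln (real N))"
proof (intro exI[of _ "1024 / \<tau>\<^sup>2"] conjI allI impI)
  \<comment> \<open>The constant solves \<open>\<tau>\<^sup>2 / 128 * (d / 4) \<le> 2 * ln N\<close>
    for \<open>d\<close>, and is independent of \<open>r\<close> and \<open>T\<close>.\<close>
  show "1024 / \<tau>\<^sup>2 > 0" using assms by simp
  fix r :: nat and T :: "nat set"
  assume r: "r \<ge> 2" and T: "T \<subseteq> {p. prime p}"
    and "\<exists>\<epsilon>::real \<Rightarrow> real. \<epsilon> \<in> o[at_top](\<lambda>_. 1) \<and>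
              (\<forall>\<^sub>F y in at_top.
                 (\<Sum>p | p \<in> T \<and> real p \<le> y. ln (real p) / sqrt (real p))
                   \<ge> (\<tau> + \<epsilon> y) * y powr (1/2))"
  then obtain \<epsilon> :: "real \<Rightarrow> real" where eps: "\<epsilon> \<in> o[at_top](\<lambda>_. 1)"
    and ev: "\<forall>\<^sub>F y in at_top. (\<Sum>p | p \<in> T \<and> real p \<le> y. ln (real p) / sqrt (real p))
                   \<ge> (\<tau> + \<epsilon> y) * y powr (1/2)"
    by blast
  \<comment> \<open>Half of \<open>\<tau>\<close> absorbs the error term, leaving the lower bound
    \<open>\<tau> / 2 * sqrt y\<close>.\<close>
  have "\<forall>\<^sub>F y in at_top. norm (\<epsilon> y) \<le> \<tau> / 2 * norm (1::real)"
    using landau_o.smallD[OF eps, of "\<tau> / 2"] assms by simp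
  with ev eventually_gt_at_top[of 0]
  have "\<forall>\<^sub>F y in at_top. \<tau>\<^sup>2 / 128 * y \<le> (\<Sum>p | p \<in> T \<and> real p \<le> y. ln (real p))"
  proof eventually_elim
    case (elim y)
    have "\<tau> / 2 * sqrt y \<le> (\<tau> + \<epsilon> y) * y powr (1/2)"
      using elim by (simp add: powr_half_sqrt)
    then show ?case
      using elim assms T by (intro sum_ln_ge_linear) auto
  qed
  then obtain y0 where y0:
    "\<And>y. y \<ge> y0 \<Longrightarrow> \<tau>\<^sup>2 / 128 * y \<le> (\<Sum>p | p \<in> T \<and> real p \<le> y. ln (real p))"
    by (auto simp: eventually_at_top_linorder)
  \<comment> \<open>Since \<open>ln N\<close> is unbounded, dimensions below \<open>4 * y0\<close>
    satisfy the claim for large \<open>N\<close>. The threshold \<open>y0\<close> depends on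
    \<open>T\<close>, but affects only how large \<open>N\<close> must be.\<close>
  have "filterlim (\<lambda>N. 1024 / \<tau>\<^sup>2 * ln (real N)) at_top sequentially"
    using assms
    by (intro filterlim_tendsto_pos_mult_at_top[OF tendsto_const]
        filterlim_compose[OF ln_at_top filterlim_real_sequentially]) auto
  then have "\<forall>\<^sub>F N in sequentially. 4 * y0 \<le> 1024 / \<tau>\<^sup>2 * ln (real N)"
    by (simp add: filterlim_at_top)
  with eventually_ge_at_top[of 1]
  show "\<forall>\<^sub>F N in sequentially. real (F1 r T N) \<le> 1024 / \<tau>\<^sup>2 * ln (real N)"
  proof eventually_elim
    case (elim N)
    define d where "d = F1 r T N"
    \<comment> \<open>The maximum is attained: the set is finite and, for \<open>N \<ge> 1\<close>,
      contains 0.\<close>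
    have d: "d \<in> cube_dims r T N"
      unfolding d_def F1_def using finite_cube_dims zero_in_cube_dims[OF T] elim
      by (intro Max_in) blast+
    show ?case
    proof (cases "d = 0 \<or> real d / 4 < y0")
      case True
      then show ?thesis using elim assms by (auto simp: d_def)
    next
      case False
      have "\<tau>\<^sup>2 / 128 * (real d / 4) \<le> 2 * ln (real N)"
        using y0[of "real d / 4"] sum_ln_le_of_cube_dims[OF r T d] False by linarith
      then show ?thesis using assms by (simp add: d_def field_simps)
    qed
  qed
qed

end
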